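(* Let $\ell \geq 2$, let $a_i, b_i > 2$ be integers for $i = 1, \dots, \ell$, and let $\alpha \geq 1$ be an integer with $2\alpha \leq a_1$. Let $H = K_{\alpha,\alpha}$ be a complete bipartite graph, viewed as a subgraph of $K_{a_1}$, and let $K_{a_1} \backslash H$ be the graph obtained from $K_{a_1}$ by deleting the edges of $H$. Suppose $$G = \big( (K_{a_1} \backslash H) \cup K_{b_1} \big) \vee (K_{a_2} \cup K_{b_2}) \vee \dots \vee (K_{a_\ell} \cup K_{b_\ell}).$$ Then $q(G) = 2$ and $MB(G) = 3$.
   Context: All graphs are finite and simple. For a graph $G$ on $n$ vertices, $\mathcal{S}(G)$ is the set of real symmetric $n\times n$ matrices (indexed by the vertices) such that for distinct vertices $u,v$ the $(u,v)$ entry is nonzero if and only if $uv$ is an edge of $G$; the diagonal entries are arbitrary. $q(A)$ is the number of distinct eigenvalues of $A$, and $q(G)=\min\{q(A): A\in\mathcal{S}(G)\}$. A graph $G$ on $n$ vertices achieves the multiplicity bipartition $[n-k,k]$, where $1\le k\leq\lfloor n/2\rfloor$, if some $A\in\mathcal{S}(G)$ has exactly two distinct eigenvalues, with multiplicities $n-k$ and $k$. For a graph $G$ with $q(G)=2$, $MB(G)$ is the least integer $k\leq \lfloor n/2\rfloor$ such that $G$ achieves $[n-k,k]$. $\vee$ denotes the join of graphs (disjoint union plus all edges between the factors), $\cup$ denotes disjoint union, and $K_a$ is the complete graph on $a$ vertices. *)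

theory Defs
  imports
    "Graph_Theory.Kuratowski"
    "Jordan_Normal_Form.Spectral_Radius"
begin

text \<open>
  A simple graph is represented as a symmetric loop-free digraph without parallel arcs: an edge
  \<open>uv\<close> is the pair of arcs \<open>(u, v)\<close>, \<open>(v, u)\<close>.
\<close>

definition delete_edges ::
    "'v pair_pre_digraph \<Rightarrow> 'v pair_pre_digraph \<Rightarrow> 'v pair_pre_digraph" where
  "delete_edges G H = \<lparr> pverts = pverts G, parcs = parcs G - parcs H \<rparr>"

definition disjoint_union ::
    "'v pair_pre_digraph \<Rightarrow> 'w pair_pre_digraph \<Rightarrow> ('v + 'w) pair_pre_digraph" where
  "disjoint_union G H =
     \<lparr> pverts = pverts G <+> pverts H,
       parcs = map_prod Inl Inl ` parcs G \<union> map_prod Inr Inr ` parcs H \<rparr>"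

text \<open>
  The join of a family of graphs, with vertices tagged by the index of the factor they come from.
\<close>

definition join_family ::
    "'i set \<Rightarrow> ('i \<Rightarrow> 'v pair_pre_digraph) \<Rightarrow> ('i \<times> 'v) pair_pre_digraph" where
  "join_family I F =
     \<lparr> pverts = (SIGMA i:I. pverts (F i)),
       parcs = {((i, u), (j, v)) | i u j v.
                  i \<in> I \<and> j \<in> I \<and> u \<in> pverts (F i) \<and> v \<in> pverts (F j) \<and>
                  (i = j \<longrightarrow> (u, v) \<in> parcs (F i))} \<rparr>"

text \<open>
  The rows and columns of a matrix of \<open>Jordan_Normal_Form\<close> are numbered, so \<open>S(G)\<close> consists of the
  matrices arising from any enumeration \<open>f\<close> of the vertices. Two enumerations give matrices that
  differ by a simultaneous permutation of rows and columns, hence have the same eigenvalues and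
  multiplicities.
\<close>

definition graph_matrices :: "'v pair_pre_digraph \<Rightarrow> real mat set" where
  "graph_matrices G =
     {A. let n = card (pverts G) in
         A \<in> carrier_mat n n \<and> transpose_mat A = A \<and>
         (\<exists>f. bij_betw f {..<n} (pverts G) \<and>
              (\<forall>i<n. \<forall>j<n. i \<noteq> j \<longrightarrow> (A $$ (i, j) \<noteq> 0 \<longleftrightarrow> (f i, f j) \<in> parcs G)))}"

definition q_mat :: "real mat \<Rightarrow> nat" where
  "q_mat A = card (spectrum A)"

definition q_graph :: "'v pair_pre_digraph \<Rightarrow> nat" where
  "q_graph G = (LEAST m. \<exists>A\<in>graph_matrices G. q_mat A = m)"

definition eigenvalue_mult :: "real mat \<Rightarrow> real \<Rightarrow> nat" where
  "eigenvalue_mult A x = order x (char_poly A)"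

definition achieves_bipartition :: "'v pair_pre_digraph \<Rightarrow> nat \<Rightarrow> bool" where
  "achieves_bipartition G k \<longleftrightarrow>
     1 \<le> k \<and> k \<le> card (pverts G) div 2 \<and>
     (\<exists>A\<in>graph_matrices G. \<exists>x y. x \<noteq> y \<and> spectrum A = {x, y} \<and>
        eigenvalue_mult A x = card (pverts G) - k \<and> eigenvalue_mult A y = k)"

text \<open>Intended for graphs with \<open>q_graph G = 2\<close>, for which a qualifying \<open>k\<close> exists.\<close>

definition MB :: "'v pair_pre_digraph \<Rightarrow> nat" where
  "MB G = (LEAST k. achieves_bipartition G k)"

end

theory Submission
  imports Defs "Jordan_Normal_Form.Jordan_Normal_Form_Uniqueness"
begin

text \<open>
  A matrix in \<open>S(G)\<close> with two eigenvalues is, up to an affine change, a symmetric projection \<open>P\<close>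
  with the off-diagonal zero pattern of \<open>G\<close>, whose trace is the multiplicity \<open>k\<close>. The columns of \<open>P\<close>
  at an independent set without isolated vertices are nonzero and pairwise orthogonal, so Bessel's
  inequality bounds the size of that set by \<open>k\<close>. One vertex on each side of \<open>H\<close> and one vertex of
  \<open>K\<^bsub>b\<^sub>1\<^esub>\<close> are independent, whence \<open>k \<ge> 3\<close>.

  Conversely, \<open>[n - 3, 3]\<close> is achieved by the Gram matrix of vectors in \<open>\<real>\<^sup>3\<close>, one for each vertex, that
  form a tight frame and are orthogonal exactly for non-adjacent vertices. Each factor uses four
  lines. For \<open>i \<ge> 2\<close>, \<open>K\<^bsub>b\<^sub>i\<^esub>\<close> lies on a line \<open>p\<close> and \<open>K\<^bsub>a\<^sub>i\<^esub>\<close> on the lines \<open>p \<times> e\<^sub>k\<close>; for \<open>i = 1\<close>, the two sides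
  of \<open>H\<close> and \<open>K\<^bsub>b\<^sub>1\<^esub>\<close> lie on three mutually orthogonal lines, and the vertices of \<open>K\<^bsub>a\<^sub>1\<^esub>\<close> outside \<open>H\<close> on a
  fourth one in the plane of \<open>H\<close>. The deviation from tightness caused by the fourth line is
  compensated by reweighting the lines of the second factor.
\<close>

section \<open>Real symmetric matrices with few eigenvalues\<close>

definition mat_trace :: "'a :: comm_monoid_add mat \<Rightarrow> 'a" where
  "mat_trace A = (\<Sum>i<dim_row A. A $$ (i, i))"

lemma mat_mult_index_sum:
  assumes "A \<in> carrier_mat n m" "B \<in> carrier_mat m k" "i < n" "j < k"
  shows "(A * B) $$ (i, j) = (\<Sum>l<m. A $$ (i, l) * B $$ (l, j))"
  using assms by (auto simp: scalar_prod_def lessThan_atLeast0 intro!: sum.cong)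

lemma mat_trace_mult_commute:
  fixes A B :: "'a :: comm_semiring_0 mat"
  assumes A: "A \<in> carrier_mat n m" and B: "B \<in> carrier_mat m n"
  shows "mat_trace (A * B) = mat_trace (B * A)"
proof -
  have "mat_trace (A * B) = (\<Sum>i<n. \<Sum>l<m. A $$ (i, l) * B $$ (l, i))"
    using A B by (simp add: mat_trace_def mat_mult_index_sum[OF A B] del: index_mult_mat(1))
  also have "\<dots> = (\<Sum>l<m. \<Sum>i<n. B $$ (l, i) * A $$ (i, l))"
    by (subst sum.swap) (simp add: mult.commute)
  also have "\<dots> = mat_trace (B * A)"
    using A B by (simp add: mat_trace_def mat_mult_index_sum[OF B A] del: index_mult_mat(1))
  finally show ?thesis .
qed

lemma mat_trace_similar:
  fixes A B :: "'a :: comm_ring_1 mat"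
  assumes "similar_mat_wit A B P Q"
  shows "mat_trace A = mat_trace B"
proof -
  define n where "n = dim_row A"
  note w = similar_mat_witD[OF n_def assms]
  have "mat_trace A = mat_trace (P * (B * Q))"
    using w by simp
  also have "\<dots> = mat_trace (B * Q * P)"
    using w by (intro mat_trace_mult_commute) auto
  also have "B * Q * P = B"
    using w by (simp add: assoc_mult_mat[of _ n n _ n _ n])
  finally show ?thesis .
qed

text \<open>The Schur form is similar to \<open>A\<close>, hence has the same trace, and carries the
  roots \<open>es\<close> on its diagonal.\<close>

lemma mat_trace_char_poly:
  fixes A :: "real mat"
  assumes A: "A \<in> carrier_mat n n" and c: "char_poly A = (\<Prod>e\<leftarrow>es. [:- e, 1:])"
  shows "mat_trace A = sum_list es"
proof -
  obtain B P Q where "schur_decomposition A es = (B, P, Q)"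
    by (cases "schur_decomposition A es")
  from schur_decomposition[OF A c this]
  have w: "similar_mat_wit A B P Q" and d: "diag_mat B = es" by auto
  have "mat_trace A = mat_trace B" by (rule mat_trace_similar[OF w])
  also have "\<dots> = sum_list (diag_mat B)"
    by (simp add: mat_trace_def diag_mat_def sum_list_sum_nth atLeast0LessThan)
  finally show ?thesis by (simp add: d)
qed

text \<open>The Hermitian form \<open>S\<close> of \<open>A\<close> at an eigenvector
  \<open>v\<close> is \<open>e\<close> times the squared norm of \<open>v\<close>. Symmetry of
  \<open>A\<close> makes \<open>S\<close> its own conjugate, so \<open>e\<close> is real.\<close>

lemma symmetric_eigenvalue_real:
  fixes A :: "real mat"
  assumes A: "A \<in> carrier_mat n n" and sym: "transpose_mat A = A"
    and ev: "eigenvalue (map_mat complex_of_real A) e"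
  shows "e \<in> \<real>"
proof -
  obtain v where v: "v \<in> carrier_vec n" "v \<noteq> 0\<^sub>v n"
    and eq: "map_mat complex_of_real A *\<^sub>v v = e \<cdot>\<^sub>v v"
    using ev A by (auto simp: eigenvalue_def eigenvector_def)
  have Aij: "A $$ (j, i) = A $$ (i, j)" if "i < n" "j < n" for i j
    using that A sym by (metis carrier_matD index_transpose_mat(1))
  have row: "(\<Sum>j<n. of_real (A $$ (i, j)) * v $ j) = e * v $ i" if "i < n" for i
  proof -
    have "(map_mat complex_of_real A *\<^sub>v v) $ i = (\<Sum>j<n. of_real (A $$ (i, j)) * v $ j)"
      using that A v by (auto simp: scalar_prod_def lessThan_atLeast0 intro!: sum.cong)
    then show ?thesis using that v eq by simp
  qed
  define N where "N = (\<Sum>i<n. (cmod (v $ i))\<^sup>2)"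
  define S where "S = (\<Sum>i<n. \<Sum>j<n. complex_of_real (A $$ (i, j)) * v $ j * cnj (v $ i))"
  have "S = (\<Sum>i<n. (\<Sum>j<n. complex_of_real (A $$ (i, j)) * v $ j) * cnj (v $ i))"
    by (simp add: S_def sum_distrib_right)
  also have "\<dots> = (\<Sum>i<n. e * of_real ((cmod (v $ i))\<^sup>2))"
    by (rule sum.cong[OF refl], subst row) (simp_all only: lessThan_iff complex_norm_square mult.assoc)
  also have "\<dots> = e * of_real N" by (simp add: N_def sum_distrib_left)
  finally have S: "S = e * of_real N" .
  have "cnj S = (\<Sum>i<n. \<Sum>j<n. complex_of_real (A $$ (i, j)) * cnj (v $ j) * v $ i)"
    by (simp add: S_def)
  also have "\<dots> = (\<Sum>j<n. \<Sum>i<n. complex_of_real (A $$ (i, j)) * cnj (v $ j) * v $ i)"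
    by (rule sum.swap)
  also have "\<dots> = S"
    unfolding S_def by (intro sum.cong refl) (auto simp: Aij mult_ac)
  finally have "cnj S = S" .
  then have "cnj e * of_real N = e * of_real N" using S by simp
  moreover have "N \<noteq> 0"
  proof -
    obtain i where "i < n" "v $ i \<noteq> 0" using v by (metis eq_vecI index_zero_vec carrier_vecD)
    then have "N > 0" unfolding N_def
      by (intro sum_pos2[of _ i]) auto
    then show ?thesis by simp
  qed
  ultimately have "cnj e = e" by simp
  then show ?thesis by (simp add: Reals_cnj_iff)
qed

text \<open>The polynomial factors over the complex numbers. Its roots there are real, so the
  factorization pulls back along the injective embedding of real polynomials.\<close>

lemma symmetric_char_poly_splits:
  fixes A :: "real mat"
  assumes A: "A \<in> carrier_mat n n" and sym: "transpose_mat A = A"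
  obtains es where "char_poly A = (\<Prod>e\<leftarrow>es. [:- e, 1:])" "length es = n"
proof -
  let ?A = "map_mat complex_of_real A"
  have A': "?A \<in> carrier_mat n n" using A by simp
  obtain as where as: "char_poly ?A = (\<Prod>a\<leftarrow>as. [:- a, 1:])" "length as = n"
    using char_poly_factorized[OF A'] by blast
  have "a \<in> \<real>" if "a \<in> set as" for a
  proof -
    have "poly (char_poly ?A) a = 0"
      using that by (auto simp: as poly_prod_list prod_list_zero_iff image_iff intro!: bexI[of _ a])
    then show ?thesis
      using symmetric_eigenvalue_real[OF A sym] eigenvalue_root_char_poly[OF A'] by blast
  qed
  then have asR: "as = map (complex_of_real \<circ> Re) as"
    by (simp add: map_idI)
  interpret map_poly_hom: map_poly_inj_idom_hom "complex_of_real" ..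
  have "map_poly complex_of_real (char_poly A) = char_poly ?A"
    by (simp add: of_real_hom.char_poly_hom[OF A])
  also have "\<dots> = (\<Prod>e\<leftarrow>map Re as. [:- complex_of_real e, 1:])"
    unfolding as by (subst asR) (simp add: o_def)
  also have "\<dots> = map_poly complex_of_real (\<Prod>e\<leftarrow>map Re as. [:- e, 1:])"
    by (simp add: map_poly_hom.hom_prod_list o_def)
  finally have "char_poly A = (\<Prod>e\<leftarrow>map Re as. [:- e, 1:])" by simp
  with as(2) show ?thesis by (intro that[of "map Re as"]) auto
qed

lemma upper_triangular_mult_index:
  fixes B C :: "'a :: semiring_0 mat"
  assumes B: "B \<in> carrier_mat n n" "upper_triangular B"
    and C: "C \<in> carrier_mat n n" "upper_triangular C" and ij: "j \<le> i" "i < n"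
  shows "(B * C) $$ (i, j) = (if i = j then B $$ (i, i) * C $$ (i, i) else 0)"
proof -
  have "B $$ (i, l) * C $$ (l, j) = (if l = i \<and> i = j then B $$ (i, i) * C $$ (i, i) else 0)"
    if "l < n" for l
    using that ij B C by (cases l i rule: linorder_cases; cases l j rule: linorder_cases)
      (auto simp: upper_triangular_def)
  then have "(B * C) $$ (i, j) =
      (\<Sum>l<n. if l = i \<and> i = j then B $$ (i, i) * C $$ (i, i) else 0)"
    using ij by (subst mat_mult_index_sum[OF B(1) C(1)]) auto
  also have "\<dots> = (if i = j then B $$ (i, i) * C $$ (i, i) else 0)"
    using ij by (cases "i = j") simp_all
  finally show ?thesis .
qed

lemma similar_mat_wit_mult:
  fixes A B :: "'a :: comm_ring_1 mat"
  assumes A: "A \<in> carrier_mat n n" "similar_mat_wit A B P Q"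
    and C: "C \<in> carrier_mat n n" "similar_mat_wit C D P Q"
  shows "similar_mat_wit (A * C) (B * D) P Q"
proof -
  note 1 = similar_mat_witD2[OF A] and 2 = similar_mat_witD2[OF C]
  have "A * C = P * B * Q * (P * D * Q)" using 1 2 by simp
  also have "\<dots> = P * B * (Q * P) * D * Q"
    using 1(5-7) 2(5) by (simp add: assoc_mult_mat[of _ n n _ n _ n] mult_carrier_mat[of _ n n _ n])
  also have "\<dots> = P * (B * D) * Q"
    using 1 2 by (simp add: assoc_mult_mat[of _ n n _ n _ n] mult_carrier_mat[of _ n n _ n])
  finally show ?thesis using 1 2 by (intro similar_mat_witI[of _ _ n]) auto
qed

text \<open>This stands in for diagonalizability. In Schur form the product is strictly upper
  triangular, since each diagonal entry of \<open>B\<close> is \<open>x\<close> or \<open>y\<close>;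
  hence \<open>N y x * N x y\<close> has trace 0. As \<open>A\<close> is symmetric,
  \<open>N y x\<close> is the transpose of \<open>N x y\<close>, so this trace is the sum of the
  squared entries of \<open>N x y\<close>.\<close>

lemma symmetric_annihilated:
  fixes A :: "real mat"
  assumes A: "A \<in> carrier_mat n n" and sym: "transpose_mat A = A"
    and c: "char_poly A = (\<Prod>e\<leftarrow>es. [:- e, 1:])" and es: "set es \<subseteq> {x, y}"
  shows "char_matrix A x * char_matrix A y = 0\<^sub>m n n"
proof -
  obtain B P Q where "schur_decomposition A es = (B, P, Q)"
    by (cases "schur_decomposition A es")
  from schur_decomposition[OF A c this]
  have w: "similar_mat_wit A B P Q" and ut: "upper_triangular B" and d: "diag_mat B = es" by auto
  have B: "B \<in> carrier_mat n n" by (fact similar_mat_witD2[OF A w])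
  define N where "N x y = char_matrix A x * char_matrix A y" for x y
  define T where "T x y = char_matrix B x * char_matrix B y" for x y
  have cA: "char_matrix A e \<in> carrier_mat n n" and cB: "char_matrix B e \<in> carrier_mat n n" for e
    using A B by auto
  have N: "N x y \<in> carrier_mat n n" and T: "T x y \<in> carrier_mat n n" for x y
    unfolding N_def T_def by (rule mult_carrier_mat[OF cA cA], rule mult_carrier_mat[OF cB cB])
  have NT: "similar_mat_wit (N x y) (T x y) P Q" for x y
    unfolding N_def T_def
    by (rule similar_mat_wit_mult[OF cA _ cA]; rule similar_mat_wit_char_matrix[OF w])
  have utc: "upper_triangular (char_matrix B e)" for e
    using ut B by (auto simp: upper_triangular_def char_matrix_def)
  have diag: "B $$ (i, i) \<in> {x, y}" if "i < n" for i
  proof -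
    have "B $$ (i, i) \<in> set (diag_mat B)" using that B by (auto simp: diag_mat_def)
    with d es show ?thesis by auto
  qed
  have T0: "T x y $$ (i, j) = 0" "T y x $$ (i, j) = 0" if "j \<le> i" "i < n" for i j
    using that diag[OF that(2)] B unfolding T_def
    by (subst upper_triangular_mult_index[OF cB utc cB utc]; auto simp: char_matrix_def)+
  have utT: "upper_triangular (T x y)" "upper_triangular (T y x)"
    using T[of x y] T[of y x] by (auto intro!: upper_triangularI T0)
  have "mat_trace (N y x * N x y) = mat_trace (T y x * T x y)"
    by (rule mat_trace_similar[OF similar_mat_wit_mult[OF N NT N NT]])
  also have "\<dots> = 0"
    unfolding mat_trace_def
  proof (rule sum.neutral, intro ballI)
    fix i assume "i \<in> {..<dim_row (T y x * T x y)}"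
    then have i: "i < n" using T[of y x] by simp
    show "(T y x * T x y) $$ (i, i) = 0"
      by (subst upper_triangular_mult_index[OF T utT(2) T utT(1)]) (use i T0 in auto)
  qed
  finally have trace0: "mat_trace (N y x * N x y) = 0" .
  have Nsym: "N y x $$ (j, i) = N x y $$ (i, j)" if "i < n" "j < n" for i j
  proof -
    have "A $$ (j, i) = A $$ (i, j)" if "i < n" "j < n" for i j
      using that A sym by (metis carrier_matD index_transpose_mat(1))
    then have "char_matrix A e $$ (i, j) = char_matrix A e $$ (j, i)" if "i < n" "j < n" for i j e
      using A that by (auto simp: char_matrix_def)
    then show ?thesis
      using that by (auto simp: N_def mat_mult_index_sum[OF cA cA] mult.commute
          simp del: index_mult_mat(1) intro!: sum.cong)
  qed
  have "mat_trace (N y x * N x y) = (\<Sum>i<n. \<Sum>j<n. (N x y $$ (j, i))\<^sup>2)"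
    unfolding mat_trace_def using N[of y x] Nsym
    by (auto simp: mat_mult_index_sum[OF N N] power2_eq_square
        simp del: index_mult_mat(1) intro!: sum.cong)
  with trace0 have "N x y $$ (j, i) = 0" if "i < n" "j < n" for i j
    using that by (auto simp: sum_nonneg_eq_0_iff sum_nonneg)
  then show ?thesis using N[of x y] by (intro eq_matI) (auto simp: N_def)
qed

lemma order_prod_list_linear:
  "Polynomial.order x (\<Prod>e\<leftarrow>es. [:- e, 1:]) = count_list es (x :: 'a :: idom)"
proof (induction es)
  case (Cons e es)
  have "[:- e, 1:] * (\<Prod>e\<leftarrow>es. [:- e, 1:]) \<noteq> 0"
    by (simp only: mult_eq_0_iff prod_list_zero_iff) auto
  then show ?case
    using Cons by (simp add: order_mult order_linear' del: mult_pCons_left)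
qed simp

lemma spectrum_char_poly_linear:
  fixes A :: "'a :: field mat"
  assumes "A \<in> carrier_mat n n" and "char_poly A = (\<Prod>e\<leftarrow>es. [:- e, 1:])"
  shows "spectrum A = set es"
  using assms by (auto simp: spectrum_root_char_poly poly_prod_list prod_list_zero_iff image_iff
      intro!: bexI)

lemma sum_list_two_values:
  fixes x y :: real
  assumes "set es \<subseteq> {x, y}" and "x \<noteq> y"
  shows "sum_list es = real (count_list es x) * x + real (count_list es y) * y"
    and "length es = count_list es x + count_list es y"
  using assms by (induction es) (auto simp: algebra_simps)

lemma char_matrix_mult:
  fixes A :: "'a :: field mat"
  assumes A: "A \<in> carrier_mat n n" and ij: "i < n" "j < n"
  shows "(char_matrix A x * char_matrix A y) $$ (i, j) =
    (\<Sum>l<n. (A $$ (i, l) - (if i = l then x else 0)) * (A $$ (l, j) - (if l = j then y else 0)))"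
  using A ij
  by (subst mat_mult_index_sum[of _ n n _ n]) (auto simp: char_matrix_def intro!: sum.cong)

text \<open>Bessel's inequality for the columns of a projection, summed over the standard basis.\<close>

lemma card_orthogonal_columns_le_trace:
  fixes P :: "nat \<Rightarrow> nat \<Rightarrow> real"
  assumes idem: "\<And>i j. i < n \<Longrightarrow> j < n \<Longrightarrow> (\<Sum>l<n. P i l * P l j) = P i j"
    and sym: "\<And>i j. i < n \<Longrightarrow> j < n \<Longrightarrow> P i j = P j i"
    and S: "S \<subseteq> {..<n}"
    and orth: "\<And>s t. s \<in> S \<Longrightarrow> t \<in> S \<Longrightarrow> s \<noteq> t \<Longrightarrow> P s t = 0"
    and nz: "\<And>s. s \<in> S \<Longrightarrow> P s s \<noteq> 0"
  shows "real (card S) \<le> (\<Sum>i<n. P i i)"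
proof -
  have fin: "finite S" using S finite_subset by blast
  \<comment> \<open>With symmetry, idempotence says that \<open>P\<close> is the Gram matrix of its
    own columns; column \<open>s\<close> has squared norm \<open>P s s\<close>.\<close>
  have PP: "(\<Sum>i<n. P i j * P i k) = P j k" if "j < n" "k < n" for j k
    using idem[OF that] sym that by (smt (verit, best) lessThan_iff sum.cong)
  define c where "c j s = P j s / P s s" for j s
  \<comment> \<open>Expand the squared distance from column \<open>j\<close> to its projection on
    the span of the columns in \<open>S\<close>; the \<open>c j s\<close> are the Fourier
    coefficients.\<close>
  have bessel: "(\<Sum>s\<in>S. (P j s)\<^sup>2 / P s s) \<le> P j j" if j: "j < n" for j
  proof -
    have "0 \<le> (\<Sum>i<n. (P i j - (\<Sum>s\<in>S. c j s * P i s))\<^sup>2)" by (simp add: sum_nonneg)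
    also have "\<dots> = (\<Sum>i<n. P i j * P i j - 2 * (\<Sum>s\<in>S. c j s * (P i j * P i s))
        + (\<Sum>s\<in>S. \<Sum>t\<in>S. c j s * c j t * (P i s * P i t)))"
      by (intro sum.cong refl)
        (simp add: power2_eq_square algebra_simps sum_distrib_left sum_product)
    also have "\<dots> = (\<Sum>i<n. P i j * P i j) - 2 * (\<Sum>s\<in>S. c j s * (\<Sum>i<n. P i j * P i s))
        + (\<Sum>s\<in>S. \<Sum>t\<in>S. c j s * c j t * (\<Sum>i<n. P i s * P i t))"
      by (simp add: sum.distrib sum_subtractf sum_distrib_left sum.swap[of _ "{..<n}"]
          mult.left_commute)
    also have "(\<Sum>i<n. P i j * P i j) = P j j" using j j by (rule PP)
    also have "(\<Sum>s\<in>S. c j s * (\<Sum>i<n. P i j * P i s)) = (\<Sum>s\<in>S. (P j s)\<^sup>2 / P s s)"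
      using S j by (intro sum.cong refl, subst PP) (auto simp: c_def power2_eq_square)
    also have "(\<Sum>s\<in>S. \<Sum>t\<in>S. c j s * c j t * (\<Sum>i<n. P i s * P i t)) =
        (\<Sum>s\<in>S. \<Sum>t\<in>S. if s = t then (P j s)\<^sup>2 / P s s else 0)"
      using S nz by (intro sum.cong refl, subst PP)
        (auto simp: c_def power2_eq_square orth)
    also have "\<dots> = (\<Sum>s\<in>S. (P j s)\<^sup>2 / P s s)"
      using fin by (simp add: sum.delta)
    finally show ?thesis by simp
  qed
  \<comment> \<open>Each \<open>s\<close> contributes 1, its squared column norm divided by
    \<open>P s s\<close>.\<close>
  have "real (card S) = (\<Sum>s\<in>S. (\<Sum>j<n. P j s * P j s) / P s s)"
    using S nz by (simp add: PP subset_iff)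
  also have "\<dots> = (\<Sum>j<n. \<Sum>s\<in>S. (P j s)\<^sup>2 / P s s)"
    by (subst sum.swap) (simp add: sum_divide_distrib power2_eq_square)
  also have "\<dots> \<le> (\<Sum>j<n. P j j)"
    by (intro sum_mono bessel) simp
  finally show ?thesis .
qed

section \<open>Multiplicity bipartitions of graphs\<close>

lemma graph_matricesD:
  assumes "A \<in> graph_matrices G" and "n = card (pverts G)"
  shows "A \<in> carrier_mat n n" "transpose_mat A = A"
    "\<exists>f. bij_betw f {..<n} (pverts G) \<and>
       (\<forall>i<n. \<forall>j<n. i \<noteq> j \<longrightarrow> (A $$ (i, j) \<noteq> 0 \<longleftrightarrow> (f i, f j) \<in> parcs G))"
  using assms by (auto simp: graph_matrices_def Let_def)

text \<open>A single eigenvalue \<open>x\<close> would give \<open>(A - x)^2 = 0\<close>. A diagonal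
  entry of this square is the sum of the squares of a row of \<open>A - x\<close>, and an edge makes
  one of them positive.\<close>

lemma q_mat_ge_2:
  assumes A: "A \<in> graph_matrices G"
    and uv: "u \<in> pverts G" "v \<in> pverts G" "u \<noteq> v" "(u, v) \<in> parcs G"
  shows "q_mat A \<ge> 2"
proof -
  define n where "n = card (pverts G)"
  note A = graph_matricesD[OF A n_def]
  from A(3) obtain f where f: "bij_betw f {..<n} (pverts G)"
    and adj: "\<And>i j. i < n \<Longrightarrow> j < n \<Longrightarrow> i \<noteq> j \<Longrightarrow> A $$ (i, j) \<noteq> 0 \<longleftrightarrow> (f i, f j) \<in> parcs G"
    by blast
  obtain i j where ij: "i < n" "j < n" "f i = u" "f j = v"
    using uv f unfolding bij_betw_def by (metis imageE lessThan_iff)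
  then have "i \<noteq> j" "A $$ (i, j) \<noteq> 0" using uv adj by auto
  obtain es where es: "char_poly A = (\<Prod>e\<leftarrow>es. [:- e, 1:])" "length es = n"
    using symmetric_char_poly_splits[OF A(1,2)] .
  have spec: "spectrum A = set es" using spectrum_char_poly_linear[OF A(1) es(1)] .
  show ?thesis
  proof (rule ccontr)
    assume "\<not> q_mat A \<ge> 2"
    then have "card (set es) \<le> 1" by (simp add: q_mat_def spec)
    moreover have "es \<noteq> []" using es(2) ij(1) by auto
    \<comment> \<open>The repeated element lets \<open>symmetric_annihilated\<close> be used with
      both roots equal.\<close>
    ultimately have "set es \<subseteq> {hd es, hd es}"
      by (metis card_le_Suc0_iff_eq One_nat_def List.finite_set hd_in_set insert_absorb2
          singletonI subsetI)
    define x where "x = hd es"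
    have "char_matrix A x * char_matrix A x = 0\<^sub>m n n"
      using symmetric_annihilated[OF A(1,2) es(1)] \<open>set es \<subseteq> _\<close> unfolding x_def by blast
    then have "0 = (char_matrix A x * char_matrix A x) $$ (i, i)" using ij by simp
    also have "\<dots> = (\<Sum>l<n. (A $$ (i, l) - (if i = l then x else 0))\<^sup>2)"
    proof -
      have "A $$ (l, i) = A $$ (i, l)" if "l < n" for l
        using that ij A(1,2) by (metis carrier_matD index_transpose_mat(1))
      then show ?thesis
        by (subst char_matrix_mult[OF A(1) ij(1) ij(1)]) (auto simp: power2_eq_square intro!: sum.cong)
    qed
    finally have "(A $$ (i, j) - (if i = j then x else 0))\<^sup>2 = 0"
      using ij by (simp add: sum_nonneg_eq_0_iff)
    with \<open>i \<noteq> j\<close> \<open>A $$ (i, j) \<noteq> 0\<close> show False by simp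
  qed
qed

text \<open>The normalization \<open>P = (A - x) / (y - x)\<close> sends the eigenvalue of
  multiplicity \<open>n - k\<close> to 0 and the other to 1, so its trace is \<open>k\<close>.
  Independence makes the off-diagonal entries on the set vanish; a neighbour keeps the diagonal
  entry, a squared row norm, away from 0.\<close>

lemma achieves_bipartition_card_independent:
  assumes ach: "achieves_bipartition G k"
    and S: "S \<subseteq> pverts G"
    and indep: "\<And>u v. u \<in> S \<Longrightarrow> v \<in> S \<Longrightarrow> u \<noteq> v \<Longrightarrow> (u, v) \<notin> parcs G"
    and nbr: "\<And>u. u \<in> S \<Longrightarrow> \<exists>v\<in>pverts G. u \<noteq> v \<and> (u, v) \<in> parcs G"
  shows "card S \<le> k"
proof -
  define n where "n = card (pverts G)"
  from ach obtain A x y where k: "1 \<le> k" "k \<le> n div 2" and A: "A \<in> graph_matrices G"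
    and xy: "x \<noteq> y" and spec: "spectrum A = {x, y}"
    and mult: "eigenvalue_mult A x = n - k" "eigenvalue_mult A y = k"
    unfolding achieves_bipartition_def n_def by blast
  note A = graph_matricesD[OF A n_def]
  from A(3) obtain f where f: "bij_betw f {..<n} (pverts G)"
    and adj: "\<And>i j. i < n \<Longrightarrow> j < n \<Longrightarrow> i \<noteq> j \<Longrightarrow> A $$ (i, j) \<noteq> 0 \<longleftrightarrow> (f i, f j) \<in> parcs G"
    by blast
  obtain es where es: "char_poly A = (\<Prod>e\<leftarrow>es. [:- e, 1:])" "length es = n"
    using symmetric_char_poly_splits[OF A(1,2)] .
  have set_es: "set es = {x, y}" using spectrum_char_poly_linear[OF A(1) es(1)] spec by simp
  have "mat_trace A = sum_list es" by (rule mat_trace_char_poly[OF A(1) es(1)])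
  also have "\<dots> = real (n - k) * x + real k * y"
    using sum_list_two_values(1)[of es x y] set_es xy mult
    by (simp add: eigenvalue_mult_def es order_prod_list_linear)
  finally have tr: "(\<Sum>i<n. A $$ (i, i)) = real (n - k) * x + real k * y"
    using A(1) by (simp add: mat_trace_def)
  have zero: "char_matrix A x * char_matrix A y = 0\<^sub>m n n"
    using set_es by (intro symmetric_annihilated[OF A(1,2) es(1)]) auto
  define d where "d = y - x"
  define P where "P i j = (A $$ (i, j) - (if i = j then x else 0)) / d" for i j
  have d: "d \<noteq> 0" using xy by (simp add: d_def)
  have sym: "P i j = P j i" if "i < n" "j < n" for i j
  proof -
    have "A $$ (i, j) = A $$ (j, i)"
      using that A(1,2) by (metis carrier_matD index_transpose_mat(1))
    then show ?thesis by (simp add: P_def eq_commute)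
  qed
  have idem: "(\<Sum>l<n. P i l * P l j) = P i j" if ij: "i < n" "j < n" for i j
  proof -
    \<comment> \<open>Since \<open>A - x = d P\<close> and \<open>A - y = d P - d\<close>, the
      annihilation relation is \<open>P^2 = P\<close> up to the factor \<open>d^2\<close>.\<close>
    have "0 = (\<Sum>l<n. (A $$ (i, l) - (if i = l then x else 0)) * (A $$ (l, j) - (if l = j then y else 0)))"
      using zero ij by (subst char_matrix_mult[OF A(1) ij, symmetric]) simp
    also have "\<dots> = (\<Sum>l<n. d * P i l * (d * P l j - (if l = j then d else 0)))"
      using d by (intro sum.cong refl) (auto simp: P_def d_def)
    also have "\<dots> = (\<Sum>l<n. d\<^sup>2 * (P i l * P l j) - (if l = j then d\<^sup>2 * P i l else 0))"
      by (intro sum.cong refl) (auto simp: algebra_simps power2_eq_square)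
    also have "\<dots> = d\<^sup>2 * (\<Sum>l<n. P i l * P l j) - d\<^sup>2 * P i j"
      using ij by (simp add: sum_subtractf sum_distrib_left sum.delta)
    finally show ?thesis using d by simp
  qed
  have trP: "(\<Sum>i<n. P i i) = real k"
  proof -
    have "(\<Sum>i<n. P i i) = ((\<Sum>i<n. A $$ (i, i)) - real n * x) / d"
      by (simp add: P_def sum_divide_distrib[symmetric] sum_subtractf)
    also have "\<dots> = real k"
      unfolding tr using k d by (simp add: field_simps d_def of_nat_diff)
    finally show ?thesis .
  qed
  define T where "T = {i. i < n \<and> f i \<in> S}"
  have inj: "inj_on f {..<n}" and img: "f ` {..<n} = pverts G" using f by (auto simp: bij_betw_def)
  have "f ` T = S" using img S by (auto simp: T_def image_iff)
  moreover have "inj_on f T" using inj by (rule inj_on_subset) (auto simp: T_def)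
  ultimately have "card S = card T" using card_image by blast
  also have "real (card T) \<le> (\<Sum>i<n. P i i)"
  proof (rule card_orthogonal_columns_le_trace[OF idem sym])
    show "T \<subseteq> {..<n}" by (auto simp: T_def)
    show "P s t = 0" if "s \<in> T" "t \<in> T" "s \<noteq> t" for s t
    proof -
      have "f s \<noteq> f t" using that inj by (auto simp: T_def inj_on_def)
      then show ?thesis using that indep adj[of s t] by (auto simp: T_def P_def)
    qed
    show "P s s \<noteq> 0" if "s \<in> T" for s
    proof -
      have s: "s < n" "f s \<in> S" using that by (auto simp: T_def)
      obtain v where v: "v \<in> pverts G" "f s \<noteq> v" "(f s, v) \<in> parcs G" using nbr s by blast
      obtain t where t: "t < n" "f t = v" using v img by (metis imageE lessThan_iff)
      have "P s t \<noteq> 0" using s t v adj[of s t] d by (auto simp: P_def)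
      moreover have "P s s = (\<Sum>l<n. (P s l)\<^sup>2)"
        using idem[OF s(1) s(1)] sym[OF s(1)] by (simp add: power2_eq_square)
      moreover have "(P s t)\<^sup>2 \<le> (\<Sum>l<n. (P s l)\<^sup>2)"
        using t by (intro member_le_sum) auto
      ultimately show ?thesis by (smt (verit) zero_less_power2)
    qed
  qed
  finally show ?thesis using trP by simp
qed

text \<open>If the vectors are the rows of \<open>X\<close>, then \<open>A\<close> is
  \<open>X\<close> times its transpose, while the frame condition says that the transpose times
  \<open>X\<close> is \<open>c I\<close>. Hence \<open>A^2 = c A\<close>, the eigenvalues lie in
  \<open>{0, c}\<close>, and the trace \<open>k c\<close> fixes the multiplicities.\<close>

lemma tight_frame_achieves_bipartition:
  fixes x :: "'v \<Rightarrow> nat \<Rightarrow> real"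
  assumes fin: "finite (pverts G)" and k: "1 \<le> k" "k \<le> card (pverts G) div 2"
    and adj: "\<And>u v. u \<in> pverts G \<Longrightarrow> v \<in> pverts G \<Longrightarrow> u \<noteq> v \<Longrightarrow>
        (\<Sum>i<k. x u i * x v i) \<noteq> 0 \<longleftrightarrow> (u, v) \<in> parcs G"
    and frame: "\<And>i j. i < k \<Longrightarrow> j < k \<Longrightarrow> (\<Sum>v\<in>pverts G. x v i * x v j) = (if i = j then c else 0)"
    and c: "c \<noteq> 0"
  shows "achieves_bipartition G k"
proof -
  define n where "n = card (pverts G)"
  obtain f where f: "bij_betw f {..<n} (pverts G)"
    using fin unfolding n_def by (metis ex_bij_betw_nat_finite atLeast0LessThan)
  define A where "A = mat n n (\<lambda>(r, s). \<Sum>i<k. x (f r) i * x (f s) i)"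
  have A: "A \<in> carrier_mat n n" by (simp add: A_def)
  have sym: "transpose_mat A = A" by (rule eq_matI) (auto simp: A_def mult.commute)
  have memf: "f r \<in> pverts G" if "r < n" for r using f that by (auto simp: bij_betw_def)
  have AG: "A \<in> graph_matrices G"
  proof -
    have "A $$ (r, s) \<noteq> 0 \<longleftrightarrow> (f r, f s) \<in> parcs G" if "r < n" "s < n" "r \<noteq> s" for r s
    proof -
      have "f r \<noteq> f s" using f that by (auto simp: bij_betw_def inj_on_def)
      then show ?thesis using adj[OF memf memf] that by (simp add: A_def)
    qed
    then show ?thesis
      using A sym f unfolding graph_matrices_def Let_def n_def[symmetric] by blast
  qed
  have frame': "(\<Sum>r<n. x (f r) i * x (f r) j) = (if i = j then c else 0)" if "i < k" "j < k" for i j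
    using frame[OF that] sum.reindex_bij_betw[OF f, of "\<lambda>v. x v i * x v j"] by simp
  have AA: "(A * A) $$ (r, s) = c * A $$ (r, s)" if rs: "r < n" "s < n" for r s
  proof -
    have "(A * A) $$ (r, s) =
        (\<Sum>l<n. \<Sum>i<k. \<Sum>j<k. x (f r) i * x (f s) j * (x (f l) i * x (f l) j))"
      using rs by (subst mat_mult_index_sum[OF A A]) (simp_all add: A_def sum_product mult_ac)
    also have "\<dots> = (\<Sum>i<k. \<Sum>j<k. x (f r) i * x (f s) j * (\<Sum>l<n. x (f l) i * x (f l) j))"
      by (simp add: sum.swap[of _ "{..<n}"] sum_distrib_left)
    also have "\<dots> = (\<Sum>i<k. \<Sum>j<k. if i = j then c * (x (f r) i * x (f s) j) else 0)"
      by (intro sum.cong refl) (auto simp: frame')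
    also have "\<dots> = c * A $$ (r, s)"
      using rs by (simp add: sum.delta A_def sum_distrib_left)
    finally show ?thesis .
  qed
  obtain es where es: "char_poly A = (\<Prod>e\<leftarrow>es. [:- e, 1:])" "length es = n"
    using symmetric_char_poly_splits[OF A sym] .
  have spec: "spectrum A = set es" by (rule spectrum_char_poly_linear[OF A es(1)])
  have sub: "set es \<subseteq> {0, c}"
  proof
    fix e assume "e \<in> set es"
    then obtain v where v: "v \<in> carrier_vec n" "v \<noteq> 0\<^sub>v n" "A *\<^sub>v v = e \<cdot>\<^sub>v v"
      using A spec[symmetric] by (auto simp: spectrum_def eigenvalue_def eigenvector_def)
    obtain i where i: "i < n" "v $ i \<noteq> 0" using v by (metis eq_vecI index_zero_vec carrier_vecD)
    have "(A *\<^sub>v (A *\<^sub>v v)) $ i = ((A * A) *\<^sub>v v) $ i"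
      using A v by (simp add: assoc_mult_mat_vec)
    also have "\<dots> = c * (A *\<^sub>v v) $ i"
    proof -
      have "(M *\<^sub>v v) $ i = (\<Sum>l<n. M $$ (i, l) * v $ l)" if "M \<in> carrier_mat n n" for M
        using that v i by (auto simp: scalar_prod_def lessThan_atLeast0 intro!: sum.cong)
      then show ?thesis
        using A i by (simp add: sum_distrib_left mult.assoc AA del: index_mult_mat(1) index_mult_mat_vec)
    qed
    finally have "e * (e * v $ i) = c * (e * v $ i)"
      using A v i by (simp add: mult_mat_vec[of A n n] del: index_mult_mat_vec)
    then show "e \<in> {0, c}" using i by auto
  qed
  have "mat_trace A = real (count_list es c) * c"
    using mat_trace_char_poly[OF A es(1)] sum_list_two_values(1)[OF sub] c by simp
  moreover have "mat_trace A = real k * c"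
  proof -
    have "mat_trace A = (\<Sum>i<k. \<Sum>r<n. x (f r) i * x (f r) i)"
      by (simp add: mat_trace_def A_def) (rule sum.swap)
    then show ?thesis by (simp add: frame')
  qed
  ultimately have cc: "count_list es c = k" using c by simp
  have c0: "count_list es 0 = n - k" using sum_list_two_values(2)[OF sub] c cc es(2) by simp
  \<comment> \<open>Both eigenvalues occur: \<open>k \<ge> 1\<close>, and
    \<open>k \<le> n div 2\<close> leaves \<open>n - k\<close> positive.\<close>
  have "0 \<in> set es" "c \<in> set es"
    using cc c0 k unfolding n_def[symmetric] by (auto simp: count_list_0_iff intro: ccontr)
  then have "spectrum A = {0, c}" using sub spec by auto
  moreover have "eigenvalue_mult A 0 = n - k" "eigenvalue_mult A c = k"
    using cc c0 by (simp_all add: eigenvalue_mult_def es(1) order_prod_list_linear)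
  ultimately show ?thesis
    unfolding achieves_bipartition_def n_def[symmetric]
    using k[folded n_def] AG c[symmetric] by blast
qed

lemma achieves_bipartition_q_mat:
  assumes "achieves_bipartition G k"
  shows "\<exists>A\<in>graph_matrices G. q_mat A = 2"
  using assms by (auto simp: achieves_bipartition_def q_mat_def intro!: bexI)

text \<open>Vertices of one class share a direction, and the weight \<open>w a\<close> of the class
  is divided equally among them by scaling with \<open>sqrt (w a / n a)\<close>. The frame condition
  thus becomes independent of the class sizes.\<close>

lemma weighted_lines_achieve_bipartition:
  fixes cls :: "'v \<Rightarrow> 'a" and d :: "'a \<Rightarrow> nat \<Rightarrow> real" and w :: "'a \<Rightarrow> real"
  assumes fin: "finite (pverts G)" and k: "1 \<le> k" "k \<le> card (pverts G) div 2"
    and adj: "\<And>u v. u \<in> pverts G \<Longrightarrow> v \<in> pverts G \<Longrightarrow> u \<noteq> v \<Longrightarrow>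
        (\<Sum>i<k. d (cls u) i * d (cls v) i) \<noteq> 0 \<longleftrightarrow> (u, v) \<in> parcs G"
    and w: "\<And>a. a \<in> cls ` pverts G \<Longrightarrow> w a > 0"
    and frame: "\<And>i j. i < k \<Longrightarrow> j < k \<Longrightarrow>
        (\<Sum>a\<in>cls ` pverts G. w a * (d a i * d a j)) = (if i = j then c else 0)"
    and c: "c \<noteq> 0"
  shows "achieves_bipartition G k"
proof -
  let ?V = "pverts G"
  define n where "n a = card {v \<in> ?V. cls v = a}" for a
  have n: "n a > 0" if "a \<in> cls ` ?V" for a
    using that fin by (auto simp: n_def card_gt_0_iff)
  define s where "s a = sqrt (w a / n a)" for a
  have s: "s a \<noteq> 0" "s a * s a = w a / n a" if "a \<in> cls ` ?V" for a
    using w[OF that] n[OF that] by (simp_all add: s_def)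
  show ?thesis
  proof (rule tight_frame_achieves_bipartition[where x = "\<lambda>v i. s (cls v) * d (cls v) i", OF fin k _ _ c])
    fix u v assume uv: "u \<in> ?V" "v \<in> ?V" "u \<noteq> v"
    have "(\<Sum>i<k. s (cls u) * d (cls u) i * (s (cls v) * d (cls v) i)) =
        s (cls u) * s (cls v) * (\<Sum>i<k. d (cls u) i * d (cls v) i)"
      by (simp add: sum_distrib_left mult_ac)
    then show "(\<Sum>i<k. s (cls u) * d (cls u) i * (s (cls v) * d (cls v) i)) \<noteq> 0 \<longleftrightarrow> (u, v) \<in> parcs G"
      using adj[OF uv] s(1) uv by simp
  next
    fix i j assume ij: "i < k" "j < k"
    have "(\<Sum>v\<in>?V. s (cls v) * d (cls v) i * (s (cls v) * d (cls v) j)) =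
        (\<Sum>a\<in>cls ` ?V. \<Sum>v\<in>{v \<in> ?V. cls v = a}. s (cls v) * d (cls v) i * (s (cls v) * d (cls v) j))"
      using fin by (subst sum.image_gen[of _ _ cls]) auto
    also have "\<dots> = (\<Sum>a\<in>cls ` ?V. w a * (d a i * d a j))"
    proof (rule sum.cong[OF refl])
      fix a assume a: "a \<in> cls ` ?V"
      have "(\<Sum>v\<in>{v \<in> ?V. cls v = a}. s (cls v) * d (cls v) i * (s (cls v) * d (cls v) j)) =
          (\<Sum>v\<in>{v \<in> ?V. cls v = a}. s a * s a * (d a i * d a j))"
        by (intro sum.cong refl) auto
      also have "\<dots> = w a * (d a i * d a j)"
        using n[OF a] by (simp add: s(2)[OF a] flip: n_def)
      finally show "(\<Sum>v\<in>{v \<in> ?V. cls v = a}. s (cls v) * d (cls v) i * (s (cls v) * d (cls v) j)) =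
          w a * (d a i * d a j)" .
    qed
    finally show "(\<Sum>v\<in>?V. s (cls v) * d (cls v) i * (s (cls v) * d (cls v) j)) =
        (if i = j then c else 0)"
      using frame[OF ij] by simp
  qed
qed

section \<open>Lines in three-dimensional space\<close>

text \<open>
  For \<open>i \<ge> 2\<close> the entries are \<open>p \<times> e\<^sub>1, p \<times> e\<^sub>2, p \<times> e\<^sub>3, p\<close> with \<open>p = (1, t, t\<^sup>2)\<close> and \<open>t = i - 1\<close>. Their
  squares \<open>v v\<^sup>T\<close> add up to \<open>\<bar>p\<bar>\<^sup>2 I\<close>, and \<open>(p \<times> e\<^sub>j) \<bullet> (p \<times> e\<^sub>k) = - p\<^sub>j p\<^sub>k\<close> for \<open>j \<noteq> k\<close>. For \<open>i = 1\<close> the entries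
  are \<open>f\<^sub>1, f\<^sub>2, f\<^sub>1 + f\<^sub>2, f\<^sub>3\<close> for an orthogonal basis \<open>f\<close>, chosen so that no two lines of different
  index are orthogonal.
\<close>

definition line :: "nat \<Rightarrow> nat \<Rightarrow> int list" where
  "line i j =
     (if i = 1 then [[6, 2, 3], [-3, 6, 2], [3, 8, 5], [2, 3, -6]] ! j
      else let t = int i - 1 in [[0, t\<^sup>2, - t], [- t\<^sup>2, 0, 1], [t, - 1, 0], [1, t, t\<^sup>2]] ! j)"

text \<open>The non-adjacency pattern inside one factor: index 3 belongs to the clique
  \<open>B i\<close> and the smaller ones to \<open>A i\<close>; in factor 1 the indices 0 and 1 are
  the two sides of \<open>H\<close>.\<close>

definition orthogonal_lines :: "nat \<Rightarrow> nat \<Rightarrow> nat \<Rightarrow> bool" where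
  "orthogonal_lines i j j' \<longleftrightarrow>
     (j = 3 \<longleftrightarrow> j' \<noteq> 3) \<or> i = 1 \<and> (j = 0 \<and> j' = 1 \<or> j = 1 \<and> j' = 0)"

lemma less_4_cases: "j < 4 \<Longrightarrow> j = 0 \<or> j = 1 \<or> j = 2 \<or> j = (3 :: nat)"
  by auto

lemma line_mult_first:
  assumes "j < 4" "j' < 4" "i > 1"
  shows "(\<Sum>k<3. line 1 j ! k * line i j' ! k) \<noteq> 0"
proof -
  define t where "t = int i - 1"
  have t: "t \<ge> 1" "i \<noteq> 1" using assms(3) by (simp_all add: t_def)
  have tt: "t * t \<ge> t" using t(1) by simp
  \<comment> \<open>A product that is not settled by inequalities for \<open>t \<ge> 1\<close> could
    vanish only if one of these equations held, and each fails modulo 2 or 3.\<close>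
  have parity: "2 * t \<noteq> 3" "2 * (t * t) \<noteq> 1" "8 * t \<noteq> 5" "3 * (t * t) \<noteq> 5" "3 * t \<noteq> 8"
    by presburger+
  show ?thesis
    using less_4_cases[OF assms(1)] less_4_cases[OF assms(2)] t parity
    by (elim disjE) (simp_all add: line_def eval_nat_numeral lessThan_Suc Let_def flip: t_def;
        use tt in linarith)+
qed

lemma line_mult_same:
  assumes "j < 4" "j' < 4" "i \<ge> 1"
  shows "(\<Sum>k<3. line i j ! k * line i j' ! k) = 0 \<longleftrightarrow> orthogonal_lines i j j'"
proof (cases "i = 1")
  case True
  then show ?thesis
    using less_4_cases[OF assms(1)] less_4_cases[OF assms(2)]
    by (elim disjE) (simp_all add: line_def orthogonal_lines_def eval_nat_numeral lessThan_Suc)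
next
  case False
  define t where "t = int i - 1"
  have t: "t \<ge> 1" using False assms(3) by (simp add: t_def)
  have sq: "t * t \<ge> 0" "t * t * (t * t) \<ge> 0" by simp_all
  show ?thesis
    using less_4_cases[OF assms(1)] less_4_cases[OF assms(2)] t False
    by (elim disjE) (simp_all add: line_def orthogonal_lines_def eval_nat_numeral lessThan_Suc
        Let_def flip: t_def; use sq in linarith)+
qed

text \<open>For \<open>p = (1, t, t^2)\<close> and \<open>q = (1, s, s^2)\<close>, the product of
  \<open>p \<times> e_k\<close> with \<open>q\<close> is up to sign a coordinate of
  \<open>p \<times> q\<close>, that is \<open>t s (t - s)\<close>, \<open>t^2 - s^2\<close> or
  \<open>t - s\<close>; with positive parameters these vanish only for \<open>t = s\<close>. All
  other products have terms of one sign only.\<close>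

lemma line_mult_other:
  assumes "j < 4" "j' < 4" "i > 1" "i' > 1" "i \<noteq> i'"
  shows "(\<Sum>k<3. line i j ! k * line i' j' ! k) \<noteq> 0"
proof -
  define s t where "s = int i' - 1" and "t = int i - 1"
  have st: "s \<ge> 1" "t \<ge> 1" "t \<noteq> s" "i \<noteq> 1" "i' \<noteq> 1" using assms by (simp_all add: s_def t_def)
  have "t * s > 0" "t * t * (s * s) \<ge> 0" using st by simp_all
  moreover have "t * t \<noteq> s * s" "s * s \<noteq> t * t" using st by (auto simp: square_eq_iff)
  ultimately have "t * s + t * t * (s * s) \<noteq> 0" "1 + t * t * (s * s) \<noteq> 0" "1 + t * s \<noteq> 0"
    "t * t * (s * s) + (t * s + 1) \<noteq> 0" "t * t \<noteq> s * s" "s * s \<noteq> t * t"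
    by linarith+
  then show ?thesis
    using less_4_cases[OF assms(1)] less_4_cases[OF assms(2)] st
    by (elim disjE) (simp_all add: line_def eval_nat_numeral lessThan_Suc Let_def
        flip: s_def t_def)
qed

lemma line_mult_eq_0_iff:
  assumes "i \<ge> 1" "i' \<ge> 1" "j < 4" "j' < 4"
  shows "(\<Sum>k<3. real_of_int (line i j ! k) * real_of_int (line i' j' ! k)) = 0 \<longleftrightarrow>
    i = i' \<and> orthogonal_lines i j j'"
proof -
  have "(\<Sum>k<3. line i j ! k * line i' j' ! k) = 0 \<longleftrightarrow> i = i' \<and> orthogonal_lines i j j'"
  proof -
    consider "i = i'" | "i = 1" "i' > 1" | "i > 1" "i' = 1" | "i > 1" "i' > 1" "i \<noteq> i'"
      using assms(1,2) by linarith
    then show ?thesis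
    proof cases
      case 3
      then show ?thesis using line_mult_first[OF assms(4,3), of i] by (simp add: mult.commute)
    qed (use assms line_mult_same line_mult_first line_mult_other in auto)
  qed
  moreover have "(\<Sum>k<3. real_of_int (line i j ! k) * real_of_int (line i' j' ! k)) =
      real_of_int (\<Sum>k<3. line i j ! k * line i' j' ! k)" by simp
  ultimately show ?thesis by (simp only: of_int_eq_0_iff)
qed

text \<open>
  Let \<open>m\<^sub>1, m\<^sub>2, m\<^sub>3, p\<close> be the lines of index 2 and \<open>f\<^sub>1, f\<^sub>2, w, f\<^sub>3\<close> those of index 1. Since
  \<open>f\<^sub>1 + f\<^sub>2 = w\<close> and \<open>(-5 f\<^sub>1 + 11 f\<^sub>2) / 7 = 8 m\<^sub>1 + 9 m\<^sub>2\<close>, writing \<open>[v]\<close> for \<open>v v\<^sup>T\<close> one has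
  \<open>49 (-8 [m\<^sub>1] + 9 [m\<^sub>2] + 72 [m\<^sub>3]) + 55 [w] = 80 [f\<^sub>1] + 176 [f\<^sub>2]\<close>. The weights add this relation to
  \<open>441 ([m\<^sub>1] + [m\<^sub>2] + [m\<^sub>3] + [p]) + 196 ([f\<^sub>1] + [f\<^sub>2] + [f\<^sub>3])\<close>, a multiple of the identity.
\<close>

definition line_weight :: "bool \<Rightarrow> nat \<Rightarrow> nat \<Rightarrow> real" where
  "line_weight r i j =
     (if r \<and> i = 1 then [116, 20, 55, 196] ! j
      else if r \<and> i = 2 then [49, 882, 3969, 441] ! j
      else 1)"

text \<open>The flag \<open>r\<close> tells whether the first clique has a vertex outside
  \<open>H\<close>; otherwise its line \<open>f_1 + f_2\<close> carries no vertex and is left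
  out.\<close>

definition line_indices :: "bool \<Rightarrow> nat \<Rightarrow> (nat \<times> nat) set" where
  "line_indices r l = {1..l} \<times> {..<4} - (if r then {} else {(1, 2)})"

lemma line_weight_pos: "j < 4 \<Longrightarrow> line_weight r i j > 0"
  using less_4_cases[of j] by (auto simp: line_weight_def numeral_2_eq_2 numeral_3_eq_3)

lemma line_frame:
  assumes "l \<ge> 2"
  obtains c where "c \<noteq> 0" "\<And>x y. x < 3 \<Longrightarrow> y < 3 \<Longrightarrow>
    (\<Sum>(i, j)\<in>line_indices r l. line_weight r i j *
       (real_of_int (line i j ! x) * real_of_int (line i j ! y))) = (if x = y then c else 0)"
proof
  define q where "q i = 1 + (real i - 1)\<^sup>2 + (real i - 1) ^ 4" for i
  \<comment> \<open>Here \<open>q i\<close> is the squared length of \<open>p\<close> for factor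
    \<open>i\<close>. The vectors \<open>f_k\<close> have squared length 49 and
    \<open>(1, 1, 1)\<close> has 3, whence \<open>10927 = 196 * 49 + 441 * 3\<close> and, for unit
    weights, \<open>52 = 49 + 3\<close>.\<close>
  define c where "c = (if r then 10927 else 52) + (\<Sum>i\<in>{3..l}. q i)"
  have "(\<Sum>i\<in>{3..l}. q i) \<ge> 0" by (intro sum_nonneg) (simp add: q_def)
  then show "c \<noteq> 0" by (simp add: c_def)
  fix x y :: nat assume xy: "x < 3" "y < 3"
  define g where "g i j = line_weight r i j *
    (real_of_int (line i j ! x) * real_of_int (line i j ! y))" for i j
  \<comment> \<open>Extension by zero at the omitted index turns the sum into one over a full
    rectangle.\<close>
  define h where "h i j = (if \<not> r \<and> i = 1 \<and> j = 2 then 0 else g i j)" for i j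
  have x: "x = 0 \<or> x = 1 \<or> x = 2" and y: "y = 0 \<or> y = 1 \<or> y = 2" using xy by auto
  have "(\<Sum>(i, j)\<in>line_indices r l. g i j) = (\<Sum>(i, j)\<in>{1..l} \<times> {..<4}. h i j)"
    by (intro sum.mono_neutral_cong_left) (auto simp: line_indices_def h_def split: if_splits)
  also have "\<dots> = (\<Sum>i\<in>{1..l}. \<Sum>j<4. h i j)"
    by (simp add: sum.cartesian_product)
  \<comment> \<open>From the third on each factor is tight by itself; the first two are evaluated
    together, since with \<open>r\<close> only their sum is tight.\<close>
  also have "{1..l} = insert 1 (insert 2 {3..l})" using assms by auto
  also have "(\<Sum>i\<in>\<dots>. \<Sum>j<4. h i j) = (\<Sum>j<4. h 1 j) + (\<Sum>j<4. h 2 j) + (\<Sum>i\<in>{3..l}. \<Sum>j<4. h i j)"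
    by simp
  also have "(\<Sum>j<4. h 1 j) + (\<Sum>j<4. h 2 j) = (if x = y then if r then 10927 else 52 else 0)"
    using x y by (elim disjE; cases r)
      (simp_all add: h_def g_def line_def line_weight_def eval_nat_numeral lessThan_Suc)
  also have "(\<Sum>i\<in>{3..l}. \<Sum>j<4. h i j) = (\<Sum>i\<in>{3..l}. if x = y then q i else 0)"
  proof (rule sum.cong[OF refl])
    fix i assume "i \<in> {3..l}"
    then have i: "i \<noteq> 1" "i \<noteq> 2" by auto
    define t where "t = int i - 1"
    have q: "q i = 1 + real_of_int (t * t) + real_of_int (t * t * (t * t))"
      by (simp add: q_def t_def power2_eq_square eval_nat_numeral)
    have "h i j = real_of_int ([[0, t * t, - t], [- (t * t), 0, 1], [t, - 1, 0], [1, t, t * t]] ! j ! x) *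
        real_of_int ([[0, t * t, - t], [- (t * t), 0, 1], [t, - 1, 0], [1, t, t * t]] ! j ! y)" for j
      using i by (simp add: h_def g_def line_def line_weight_def t_def power2_eq_square Let_def)
    then show "(\<Sum>j<4. h i j) = (if x = y then q i else 0)"
      unfolding q using x y by (elim disjE) (simp_all add: eval_nat_numeral lessThan_Suc)
  qed
  finally show "(\<Sum>(i, j)\<in>line_indices r l. line_weight r i j *
       (real_of_int (line i j ! x) * real_of_int (line i j ! y))) = (if x = y then c else 0)"
    by (simp add: g_def c_def)
qed

text \<open>Serves to spread a clique \<open>A i\<close> over the three lines
  \<open>p \<times> e_k\<close> so that none stays empty; this is where \<open>a i > 2\<close>
  enters.\<close>

lemma card_ge_3_surj:
  assumes "card S > 2"
  shows "\<exists>g. g ` S = {..<3 :: nat}"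
proof -
  obtain T where T: "T \<subseteq> S" "card T = 3"
    using obtain_subset_with_card_n[of 3 S] assms by auto
  then have "finite T" by (metis card.infinite zero_neq_numeral)
  then obtain h where h: "bij_betw h T {..<3 :: nat}"
    using T(2) ex_bij_betw_finite_nat[of T] by (auto simp: atLeast0LessThan)
  have "(\<lambda>x. if x \<in> T then h x else 0) ` S = h ` T \<union> (if S = T then {} else {0})"
    using T(1) by auto
  also have "\<dots> = {..<3}" using h by (auto simp: bij_betw_def)
  finally show ?thesis by blast
qed

section \<open>The multiplicity bipartition of the join\<close>

lemma arc_disjoint_union_iff:
  "(p, q) \<in> parcs (disjoint_union G H) \<longleftrightarrow>
     (\<exists>x y. p = Inl x \<and> q = Inl y \<and> (x, y) \<in> parcs G) \<or>
     (\<exists>x y. p = Inr x \<and> q = Inr y \<and> (x, y) \<in> parcs H)"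
  unfolding disjoint_union_def by force

theorem lemma4p3:
  fixes l \<alpha> :: nat
    and a b :: "nat \<Rightarrow> nat"
    and A B :: "nat \<Rightarrow> 'v pair_pre_digraph"
    and H :: "'v pair_pre_digraph"
    and G :: "(nat \<times> ('v + 'v)) pair_pre_digraph"
  assumes "l \<ge> 2"
    and "\<And>i. i \<in> {1..l} \<Longrightarrow> a i > 2"
    and "\<And>i. i \<in> {1..l} \<Longrightarrow> b i > 2"
    and "\<alpha> \<ge> 1"
    and "2 * \<alpha> \<le> a 1"
    and "\<And>i. i \<in> {1..l} \<Longrightarrow> K\<^bsub>a i\<^esub> (with_proj (A i))"
    and "\<And>i. i \<in> {1..l} \<Longrightarrow> K\<^bsub>b i\<^esub> (with_proj (B i))"
    and "K\<^bsub>\<alpha>,\<alpha>\<^esub> (with_proj H)"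
    and "subgraph (with_proj H) (with_proj (A 1))"
    and "G = join_family {1..l}
               (\<lambda>i. disjoint_union (if i = 1 then delete_edges (A 1) H else A i) (B i))"
  shows "q_graph G = 2 \<and> MB G = 3"
proof -

  \<comment> \<open>Vertices and arcs of the join\<close>
  have A: "finite (pverts (A i))" "card (pverts (A i)) > 2"
    "\<And>u v. (u, v) \<in> parcs (A i) \<longleftrightarrow> u \<in> pverts (A i) \<and> v \<in> pverts (A i) \<and> u \<noteq> v"
    if "i \<in> {1..l}" for i
    using assms(2,6)[OF that] by (auto simp: complete_digraph_pair_def)
  have B: "finite (pverts (B i))" "card (pverts (B i)) > 2"
    "\<And>u v. (u, v) \<in> parcs (B i) \<longleftrightarrow> u \<in> pverts (B i) \<and> v \<in> pverts (B i) \<and> u \<noteq> v"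
    if "i \<in> {1..l}" for i
    using assms(3,7)[OF that] by (auto simp: complete_digraph_pair_def)
  obtain U V where UV: "pverts H = U \<union> V" "U \<inter> V = {}" "card U = \<alpha>" "card V = \<alpha>"
    and H: "parcs H = U \<times> V \<union> V \<times> U"
    using assms(8) by (auto simp: complete_bipartite_digraph_pair_def)
  have UVA: "U \<subseteq> pverts (A 1)" "V \<subseteq> pverts (A 1)"
    using assms(9) UV(1) by (auto simp: subgraph_def)
  have "U \<noteq> {}" "V \<noteq> {}" using UV(3,4) assms(4) by auto
  then obtain u v where uv: "u \<in> U" "v \<in> V" "v \<notin> U" using UV(2) by blast
  have one: "1 \<in> {1..l}" and two: "2 \<in> {1..l}" using assms(1) by auto
  obtain w where w: "w \<in> pverts (B 1)" using B(2)[OF one] by fastforce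
  obtain w' where w': "w' \<in> pverts (B 2)" using B(2)[OF two] by fastforce
  have verts: "pverts G = (SIGMA i:{1..l}. pverts (A i) <+> pverts (B i))"
    unfolding assms(10) join_family_def disjoint_union_def delete_edges_def
    by (auto split: if_splits)
  have arcs_other: "((i, p), (i', p')) \<in> parcs G"
    if "(i, p) \<in> pverts G" "(i', p') \<in> pverts G" "i \<noteq> i'" for i p i' p'
    using that unfolding assms(10) join_family_def by simp
  have arcs_same: "((i, p), (i, p')) \<in> parcs G \<longleftrightarrow>
      (\<exists>x y. p = Inl x \<and> p' = Inl y \<and> (x, y) \<in> parcs (A i) \<and> \<not> (i = 1 \<and> (x, y) \<in> parcs H)) \<or>
      (\<exists>x y. p = Inr x \<and> p' = Inr y \<and> (x, y) \<in> parcs (B i))"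
    if "(i, p) \<in> pverts G" "(i, p') \<in> pverts G" for i p p'
  proof -
    have "((i, p), (i, p')) \<in> parcs G \<longleftrightarrow>
        (p, p') \<in> parcs (disjoint_union (if i = 1 then delete_edges (A 1) H else A i) (B i))"
      using that unfolding assms(10) join_family_def by auto
    then show ?thesis by (auto simp: arc_disjoint_union_iff delete_edges_def)
  qed
  have fin: "finite (pverts G)" unfolding verts using A(1) B(1) by (intro finite_SigmaI) auto

  \<comment> \<open>Assignment of the vertices to lines\<close>
  define r where "r \<longleftrightarrow> pverts (A 1) - U - V \<noteq> {}"
  have "\<forall>i\<in>{1..l}. \<exists>g. g ` pverts (A i) = {..<3 :: nat}"
    using card_ge_3_surj A(2) by blast
  then obtain g where g: "\<And>i. i \<in> {1..l} \<Longrightarrow> g i ` pverts (A i) = {..<3 :: nat}" by metis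
  \<comment> \<open>In factor 1, \<open>U\<close>, \<open>V\<close> and the remaining vertices of
    the clique go to \<open>f_1\<close>, \<open>f_2\<close> and \<open>f_1 + f_2\<close>; in the
    others \<open>g i\<close> selects among the lines \<open>p \<times> e_k\<close>. Index 3 is
    \<open>f_3\<close> or \<open>p\<close>.\<close>
  define j where "j i p = (case p of Inl x \<Rightarrow>
      if i = 1 then if x \<in> U then 0 else if x \<in> V then 1 else 2 else g i x
    | Inr _ \<Rightarrow> 3)" for i and p :: "'v + 'v"
  define cls where "cls = (\<lambda>(i, p). (i, j i p))"
  have jA: "j i ` Inl ` pverts (A i) = {..<3} - (if i = 1 \<and> \<not> r then {2} else {})"
    if i: "i \<in> {1..l}" for i
  proof (cases "i = 1")
    case True
    have "j 1 ` Inl ` U = {0}" "j 1 ` Inl ` V = {1}"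
      using UV(2) uv by (auto simp: j_def image_iff intro!: bexI[of _ u] bexI[of _ v])
    moreover have "j 1 ` Inl ` (pverts (A 1) - U - V) = (if r then {2} else {})"
      by (auto simp: j_def image_iff r_def)
    moreover have "j 1 ` Inl ` pverts (A 1) =
        j 1 ` Inl ` U \<union> j 1 ` Inl ` V \<union> j 1 ` Inl ` (pverts (A 1) - U - V)"
      using UVA by blast
    ultimately have "j 1 ` Inl ` pverts (A 1) = {0} \<union> {1} \<union> (if r then {2} else {})"
      by (simp only:)
    then show ?thesis using True by auto
  next
    case False
    then have "j i ` Inl ` pverts (A i) = g i ` pverts (A i)"
      by (auto simp: j_def image_iff)
    then show ?thesis using g[OF i] False by simp
  qed
  have jB: "j i ` Inr ` pverts (B i) = {3}" if "i \<in> {1..l}" for i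
  proof -
    have "pverts (B i) \<noteq> {}" using B(2)[OF that] by auto
    then show ?thesis by (auto simp: j_def image_iff)
  qed
  have j_verts: "j i ` (pverts (A i) <+> pverts (B i)) = {..<4} - (if i = 1 \<and> \<not> r then {2} else {})"
    if "i \<in> {1..l}" for i
    unfolding Plus_def image_Un jA[OF that] jB[OF that] by auto
  \<comment> \<open>Equality matters, not just inclusion: the frame identity sums over all of
    \<open>line_indices r l\<close>, so each of these lines must carry a vertex.\<close>
  have cls: "cls ` pverts G = line_indices r l"
  proof -
    have "cls ` pverts G = (SIGMA i:{1..l}. j i ` (pverts (A i) <+> pverts (B i)))"
      unfolding verts cls_def by (auto simp: image_iff)
    also have "\<dots> = line_indices r l"
      by (subst Sigma_cong[OF refl j_verts]) (auto simp: line_indices_def split: if_splits)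
    finally show ?thesis .
  qed
  have j_Inl: "j i (Inl x) \<noteq> 3" if "i \<in> {1..l}" "x \<in> pverts (A i)" for i x
  proof -
    have "j i (Inl x) \<in> j i ` Inl ` pverts (A i)" using that(2) by blast
    then show ?thesis unfolding jA[OF that(1)] by auto
  qed
  have j_Inl_1: "j 1 (Inl x) = 0 \<longleftrightarrow> x \<in> U" "j 1 (Inl x) = 1 \<longleftrightarrow> x \<in> V" for x
    using UV(2) by (auto simp: j_def)
  have j_Inr: "j i (Inr y) = 3" for i y
    by (simp add: j_def)
  have adj: "(p, p') \<in> parcs G \<longleftrightarrow> \<not> (fst p = fst p' \<and> orthogonal_lines (fst p) (snd (cls p)) (snd (cls p')))"
    if pp': "p \<in> pverts G" "p' \<in> pverts G" "p \<noteq> p'" for p p'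
  proof -
    obtain i s where p: "p = (i, s)" by (cases p)
    obtain i' s' where p': "p' = (i', s')" by (cases p')
    show ?thesis
    proof (cases "i = i'")
      case False
      then show ?thesis using arcs_other pp' by (simp add: p p')
    next
      case True
      then have s: "s \<in> pverts (A i) <+> pverts (B i)" "s' \<in> pverts (A i) <+> pverts (B i)"
        "s \<noteq> s'" and i: "i \<in> {1..l}"
        using pp' by (auto simp: p p' verts)
      have "((i, s), (i, s')) \<in> parcs G \<longleftrightarrow> \<not> orthogonal_lines i (j i s) (j i s')"
      proof (cases s; cases s')
        fix x y assume eq: "s = Inl x" "s' = Inl y"
        then have xy: "x \<in> pverts (A i)" "y \<in> pverts (A i)" "x \<noteq> y" using s by auto
        have "orthogonal_lines i (j i s) (j i s') \<longleftrightarrow> i = 1 \<and> (x \<in> U \<and> y \<in> V \<or> x \<in> V \<and> y \<in> U)"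
          using j_Inl[OF i xy(1)] j_Inl[OF i xy(2)] j_Inl_1
          unfolding orthogonal_lines_def eq by metis
        moreover have "((i, s), (i, s')) \<in> parcs G \<longleftrightarrow> \<not> (i = 1 \<and> (x, y) \<in> parcs H)"
          using arcs_same[of i s s'] pp' True A(3)[OF i] xy by (simp add: p p' eq)
        ultimately show ?thesis by (auto simp: H)
      next
        fix x y assume eq: "s = Inl x" "s' = Inr y"
        then show ?thesis using arcs_same[of i s s'] pp' True s j_Inl[OF i, of x]
          by (auto simp: p p' j_Inr orthogonal_lines_def)
      next
        fix x y assume eq: "s = Inr x" "s' = Inl y"
        then show ?thesis using arcs_same[of i s s'] pp' True s j_Inl[OF i, of y]
          by (auto simp: p p' j_Inr orthogonal_lines_def)
      next
        fix x y assume eq: "s = Inr x" "s' = Inr y"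
        then show ?thesis using arcs_same[of i s s'] pp' True s B(3)[OF i]
          by (auto simp: p p' j_Inr orthogonal_lines_def)
      qed
      then show ?thesis by (simp add: p p' cls_def True)
    qed
  qed

  \<comment> \<open>Realization of the bipartition with \<open>k = 3\<close>\<close>
  have "card (line_indices r l) \<ge> 7"
  proof -
    have "card (if r then {} else {(1 :: nat, 2 :: nat)}) \<le> 1" by simp
    then have "7 \<le> card ({1..l} \<times> {..<4 :: nat}) - card (if r then {} else {(1 :: nat, 2 :: nat)})"
      using assms(1) unfolding card_cartesian_product card_atLeastAtMost card_lessThan by linarith
    also have "\<dots> \<le> card (line_indices r l)"
      unfolding line_indices_def by (intro diff_card_le_card_Diff) simp
    finally show ?thesis .
  qed
  \<comment> \<open>Seven nonempty classes give at least seven vertices, which makes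
    \<open>k = 3\<close> admissible in \<open>k \<le> n div 2\<close>.\<close>
  then have "card (pverts G) \<ge> 7"
    using card_image_le[OF fin, of cls] cls by simp
  then have k: "(1 :: nat) \<le> 3" "3 \<le> card (pverts G) div 2" by auto
  obtain c where c: "c \<noteq> 0" "\<And>x y. x < 3 \<Longrightarrow> y < 3 \<Longrightarrow>
    (\<Sum>(i, j)\<in>line_indices r l. line_weight r i j *
       (real_of_int (line i j ! x) * real_of_int (line i j ! y))) = (if x = y then c else 0)"
    using line_frame[OF assms(1)] by blast
  have ach: "achieves_bipartition G 3"
  proof (rule weighted_lines_achieve_bipartition[OF fin k, where cls = cls and c = c
        and d = "\<lambda>(i, j) x. real_of_int (line i j ! x)" and w = "\<lambda>(i, j). line_weight r i j"])
    fix p p' assume pp': "p \<in> pverts G" "p' \<in> pverts G" "p \<noteq> p'"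
    then have "cls p \<in> line_indices r l" "cls p' \<in> line_indices r l" using cls by auto
    then show "(\<Sum>x<3. (case cls p of (i, j) \<Rightarrow> \<lambda>x. real_of_int (line i j ! x)) x *
        (case cls p' of (i, j) \<Rightarrow> \<lambda>x. real_of_int (line i j ! x)) x) \<noteq> 0 \<longleftrightarrow> (p, p') \<in> parcs G"
      unfolding adj[OF pp']
      by (auto simp: cls_def line_indices_def line_mult_eq_0_iff split: prod.splits)
  next
    show "(case x of (i, j) \<Rightarrow> line_weight r i j) > 0" if "x \<in> cls ` pverts G" for x
      using that unfolding cls by (auto simp: line_indices_def intro!: line_weight_pos)
  next
    fix x y :: nat assume "x < 3" "y < 3"
    then show "(\<Sum>p\<in>cls ` pverts G. (case p of (i, j) \<Rightarrow> line_weight r i j) *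
        ((case p of (i, j) \<Rightarrow> \<lambda>x. real_of_int (line i j ! x)) x *
         (case p of (i, j) \<Rightarrow> \<lambda>x. real_of_int (line i j ! x)) y)) = (if x = y then c else 0)"
      unfolding cls using c(2) by (simp add: case_prod_beta')
  qed (fact c(1))

  \<comment> \<open>Lower bound from an independent triple\<close>
  have lower: "k \<ge> 3" if "achieves_bipartition G k" for k
  proof -
    let ?S = "{(1 :: nat, Inl u), (1, Inl v), (1, Inr w)}"
    have S: "?S \<subseteq> pverts G" using uv UVA w one by (auto simp: verts)
    have uv': "u \<noteq> v" using uv UV(2) by auto
    have "card ?S \<le> k"
    proof (rule achieves_bipartition_card_independent[OF that S])
      show "(s, t) \<notin> parcs G" if "s \<in> ?S" "t \<in> ?S" "s \<noteq> t" for s t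
      proof -
        have "s \<in> pverts G" "t \<in> pverts G" using that S by auto
        then show ?thesis
          using that adj[of s t] uv UV(2) by (auto simp: cls_def j_def orthogonal_lines_def)
      qed
      \<comment> \<open>A vertex of the second factor, available because \<open>l \<ge> 2\<close>,
        is adjacent to the whole first factor.\<close>
      show "\<exists>t\<in>pverts G. s \<noteq> t \<and> (s, t) \<in> parcs G" if s: "s \<in> ?S" for s
      proof -
        obtain x where x: "s = (1, x)" using s by auto
        have "(1, x) \<in> pverts G" using s S unfolding x by blast
        moreover have w2: "(2, Inr w') \<in> pverts G" using two w' by (auto simp: verts)
        ultimately have "(s, (2, Inr w')) \<in> parcs G" unfolding x by (rule arcs_other) simp
        then show ?thesis using w2 x by (intro bexI[of _ "(2, Inr w')"]) auto
      qed
    qed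
    then show ?thesis using uv' by simp
  qed

  \<comment> \<open>The values of \<open>q_graph\<close> and \<open>MB\<close>\<close>
  have "q_graph G = 2"
    unfolding q_graph_def
  proof (rule Least_equality)
    show "\<exists>M\<in>graph_matrices G. q_mat M = 2" by (rule achieves_bipartition_q_mat[OF ach])
    have V: "(1, Inr w) \<in> pverts G" "(2, Inr w') \<in> pverts G"
      using one two w w' by (auto simp: verts)
    then have "((1, Inr w), (2, Inr w')) \<in> parcs G" by (rule arcs_other) simp
    then show "2 \<le> m" if "\<exists>M\<in>graph_matrices G. q_mat M = m" for m
      using that q_mat_ge_2[OF _ V] by auto
  qed
  moreover have "MB G = 3"
    unfolding MB_def by (rule Least_equality) (fact ach, fact lower)
  ultimately show ?thesis ..
qed

end
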